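(* Let $\pi = \lambda \oplus \mu \oplus \rho$ where $\lambda$, $\mu$ and $\rho$ are all nonempty permutations. Then the class $\operatorname{Av}(\pi)$ is not deflatable.
   Context: A permutation $\alpha$ is contained in $\beta$ if $\beta$ has a subsequence in the same relative order as $\alpha$; a class is a set of permutations closed under taking contained permutations; $\operatorname{Av}(\pi)$ is the class of permutations not containing $\pi$. $\alpha\oplus\beta$ is the permutation consisting of a copy of $\alpha$ followed by a copy of $\beta$ whose entries are all larger than those of the copy of $\alpha$. An interval of a permutation is a set of entries whose positions and values each form a set of consecutive integers, the whole permutation not counting as an interval; a permutation is simple if all its intervals are single entries (so $1$, $12$, $21$ are simple). A class $\mathcal{C}$ is deflatable if there is a proper subclass $\mathcal{D}\subsetneq\mathcal{C}$ with $\mathcal{C}\subseteq\langle\mathcal{D}\rangle$, where the substitution closure $\langle\mathcal{D}\rangle$ is the largest class whose simple permutations are exactly those of $\mathcal{D}$; equivalently, $\mathcal{C}$ is not deflatable if and only if every permutation in $\mathcal{C}$ is contained in some simple permutation belonging to $\mathcal{C}$. *)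

theory Defs
  imports "HOL-Library.Sublist" "HOL-Combinatorics.Multiset_Permutations"
begin

text \<open>
  A permutation of length \<open>n\<close> is given in one-line notation, as a list with values
  \<open>1, \<dots>, n\<close>.  The empty permutation is allowed.
\<close>

definition is_perm :: "nat list \<Rightarrow> bool" where
  "is_perm p \<longleftrightarrow> p \<in> permutations_of_set {1..length p}"

definition order_isomorphic :: "nat list \<Rightarrow> nat list \<Rightarrow> bool" where
  "order_isomorphic xs ys \<longleftrightarrow> length xs = length ys \<and>
     (\<forall>i<length xs. \<forall>j<length xs. xs ! i < xs ! j \<longleftrightarrow> ys ! i < ys ! j)"

definition contained_in :: "nat list \<Rightarrow> nat list \<Rightarrow> bool" where
  "contained_in a b \<longleftrightarrow> (\<exists>s. subseq s b \<and> order_isomorphic s a)"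

definition perm_class :: "nat list set \<Rightarrow> bool" where
  "perm_class C \<longleftrightarrow> (\<forall>p\<in>C. is_perm p) \<and>
     (\<forall>b\<in>C. \<forall>a. is_perm a \<and> contained_in a b \<longrightarrow> a \<in> C)"

definition Av :: "nat list \<Rightarrow> nat list set" where
  "Av q = {p. is_perm p \<and> \<not> contained_in q p}"

definition direct_sum :: "nat list \<Rightarrow> nat list \<Rightarrow> nat list" (infixl "\<oplus>" 65) where
  "a \<oplus> b = a @ map (\<lambda>x. length a + x) b"

definition consecutive :: "nat set \<Rightarrow> bool" where
  "consecutive S \<longleftrightarrow> (\<exists>a b. S = {a..b})"

text \<open>
  A set of entries is represented by the set \<open>I\<close> of its (0-based) positions.
\<close>

definition perm_interval :: "nat list \<Rightarrow> nat set \<Rightarrow> bool" where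
  "perm_interval p I \<longleftrightarrow> I \<noteq> {} \<and> I \<subset> {..<length p} \<and>
     consecutive I \<and> consecutive ((!) p ` I)"

text \<open>
  The empty permutation is vacuously simple.  Excluding it would make no difference to
  whether a class containing the permutation \<open>1\<close> is deflatable.
\<close>

definition simple_perm :: "nat list \<Rightarrow> bool" where
  "simple_perm p \<longleftrightarrow> is_perm p \<and> (\<forall>I. perm_interval p I \<longrightarrow> card I = 1)"

definition simples :: "nat list set \<Rightarrow> nat list set" where
  "simples C = {p \<in> C. simple_perm p}"

text \<open>
  The greatest element is with respect to inclusion; it exists for every class, see
  \<open>substitution_closure_greatest\<close> below.
\<close>

definition substitution_closure :: "nat list set \<Rightarrow> nat list set" where
  "substitution_closure D = (GREATEST E. perm_class E \<and> simples E = simples D)"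

definition deflatable :: "nat list set \<Rightarrow> bool" where
  "deflatable C \<longleftrightarrow> (\<exists>D. perm_class D \<and> D \<subset> C \<and> C \<subseteq> substitution_closure D)"

lemma substitution_closure_eq_Union:
  assumes "perm_class D"
  shows "substitution_closure D = \<Union> {E. perm_class E \<and> simples E = simples D}"
  unfolding substitution_closure_def
proof (rule Greatest_equality)
  let ?U = "\<Union> {E. perm_class E \<and> simples E = simples D}"
  have "perm_class ?U" unfolding perm_class_def by blast
  moreover have "simples ?U = simples D"
  proof
    show "simples ?U \<subseteq> simples D" unfolding simples_def by blast
    show "simples D \<subseteq> simples ?U" using assms unfolding simples_def by blast
  qed
  ultimately show "perm_class ?U \<and> simples ?U = simples D" ..
qed blast

lemma substitution_closure_greatest:
  assumes "perm_class D"
  shows "perm_class (substitution_closure D)"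
    and "simples (substitution_closure D) = simples D"
    and "perm_class E \<Longrightarrow> simples E = simples D \<Longrightarrow> E \<subseteq> substitution_closure D"
proof -
  show "perm_class (substitution_closure D)"
    unfolding substitution_closure_eq_Union[OF assms] perm_class_def by blast
  show "simples (substitution_closure D) = simples D"
  proof
    show "simples (substitution_closure D) \<subseteq> simples D"
      unfolding substitution_closure_eq_Union[OF assms] simples_def by blast
    show "simples D \<subseteq> simples (substitution_closure D)"
      using assms unfolding substitution_closure_eq_Union[OF assms] simples_def by blast
  qed
  show "perm_class E \<Longrightarrow> simples E = simples D \<Longrightarrow> E \<subseteq> substitution_closure D"
    unfolding substitution_closure_eq_Union[OF assms] by blast
qed

lemma order_isomorphic_subseq:
  assumes "order_isomorphic s a" "subseq t a"
  shows "\<exists>t'. subseq t' s \<and> order_isomorphic t' t"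
proof -
  have len: "length s = length a" using assms(1) by (simp add: order_isomorphic_def)
  obtain N where N: "t = nths a N" using assms(2) subseq_conv_nths by blast
  define idx where "idx = filter (\<lambda>i. i \<in> N) [0..<length a]"
  have nths: "nths xs N = map ((!) xs) idx" if "length xs = length a" for xs :: "nat list"
  proof -
    have "nths xs N = map fst (filter (\<lambda>p. snd p \<in> N) (zip xs [0..<length a]))"
      unfolding nths_def that ..
    also have "zip xs [0..<length a] = map (\<lambda>i. (xs ! i, i)) [0..<length a]"
      using that by (intro nth_equalityI) auto
    finally show ?thesis by (simp add: idx_def filter_map o_def)
  qed
  have bnd: "idx ! i < length a" if "i < length idx" for i
    using nth_mem[OF that] by (auto simp: idx_def)
  have "order_isomorphic (nths s N) t"
    using assms(1) bnd len unfolding order_isomorphic_def N by (simp add: nths)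
  then show ?thesis using subseq_conv_nths by blast
qed

lemma contained_in_trans:
  assumes "contained_in a b" "contained_in b c"
  shows "contained_in a c"
proof -
  obtain s where s: "subseq s b" "order_isomorphic s a"
    using assms(1) by (auto simp: contained_in_def)
  obtain t where t: "subseq t c" "order_isomorphic t b"
    using assms(2) by (auto simp: contained_in_def)
  obtain u where u: "subseq u t" "order_isomorphic u s"
    using order_isomorphic_subseq[OF t(2) s(1)] by blast
  have "order_isomorphic u a" using u(2) s(2) by (simp add: order_isomorphic_def)
  then show ?thesis
    using subseq_order.trans[OF u(1) t(1)] by (auto simp: contained_in_def)
qed

lemma perm_class_Av: "perm_class (Av q)"
  using contained_in_trans by (auto simp: perm_class_def Av_def)

lemma is_perm_direct_sum:
  assumes "is_perm a" "is_perm b"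
  shows "is_perm (a \<oplus> b)"
proof -
  have "(+) (length a) ` {1..length b} = {length a + 1..length a + length b}"
    by (simp add: image_add_atLeastAtMost)
  with assms show ?thesis
    by (auto simp: is_perm_def permutations_of_set_def direct_sum_def distinct_map)
qed

end

theory Submission
  imports Defs Complex_Main "HOL-Library.Product_Plus"
begin

text \<open>
  Every permutation \<open>\<sigma>\<close> avoiding \<open>\<pi>\<close> is contained in a simple one that still avoids \<open>\<pi>\<close>.
  View permutations as finite point sets in the plane.  Given a proper block \<open>K\<close> of \<open>T\<close> with
  at least two points, one new point on a vertical line through \<open>K\<close> cuts \<open>K\<close>
  and lies beyond some point outside \<open>K\<close>, so that the smallest block containing \<open>K\<close>
  absorbs a point of \<open>T - K\<close>; it can be placed at a height where it takes part in no copy of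
  \<open>\<pi>\<close>.  For two fixed points, the number of points outside the smallest block containing both
  drops at each step, so any two points of \<open>\<sigma>\<close> can be forced to lie in no common proper block
  other than those containing all of \<open>\<sigma>\<close>.  Restricting to the smallest block containing \<open>\<sigma>\<close>,
  and then collapsing proper blocks (which contain at most one point of \<open>\<sigma>\<close>) to single points,
  gives a simple permutation.
\<close>

section \<open>Point sets\<close>

type_synonym point = "real \<times> real"

definition generic :: "point set \<Rightarrow> bool" where
  "generic S \<longleftrightarrow> finite S \<and> inj_on fst S \<and> inj_on snd S"

definition below_left :: "point set \<Rightarrow> point set \<Rightarrow> bool" where
  "below_left A B \<longleftrightarrow> (\<forall>a\<in>A. \<forall>b\<in>B. fst a < fst b \<and> snd a < snd b)"

text \<open>Unlike \<open>perm_interval\<close>, this admits the empty set and all of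
  \<open>S\<close>. Blocks are therefore closed under intersection of nonempty families, which gives
  smallest blocks.\<close>

definition block :: "point set \<Rightarrow> point set \<Rightarrow> bool" where
  "block S K \<longleftrightarrow> K \<subseteq> S \<and> (\<forall>t\<in>S - K. \<forall>u\<in>K. \<forall>v\<in>K.
     \<not> (fst u < fst t \<and> fst t < fst v) \<and> \<not> (snd u < snd t \<and> snd t < snd v))"

lemma below_left_mono: "below_left A B \<Longrightarrow> A' \<subseteq> A \<Longrightarrow> B' \<subseteq> B \<Longrightarrow> below_left A' B'"
  unfolding below_left_def by blast

lemma generic_subset: "generic T \<Longrightarrow> S \<subseteq> T \<Longrightarrow> generic S"
  unfolding generic_def by (meson finite_subset inj_on_subset)

lemma generic_eqI:
  "generic S \<Longrightarrow> a \<in> S \<Longrightarrow> b \<in> S \<Longrightarrow> fst a = fst b \<or> snd a = snd b \<Longrightarrow> a = b"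
  by (auto simp: generic_def inj_on_def)

lemma block_self: "block S S"
  by (simp add: block_def)

lemma block_restrict: "block T J \<Longrightarrow> S \<subseteq> T \<Longrightarrow> block S (J \<inter> S)"
  unfolding block_def by blast

lemma block_trans: "block T J \<Longrightarrow> block J I \<Longrightarrow> block T I"
  unfolding block_def by blast

lemma blockD_fst:
  "block S K \<Longrightarrow> t \<in> S \<Longrightarrow> u \<in> K \<Longrightarrow> v \<in> K \<Longrightarrow> fst u < fst t \<Longrightarrow> fst t < fst v \<Longrightarrow> t \<in> K"
  unfolding block_def by blast

lemma blockD_snd:
  "block S K \<Longrightarrow> t \<in> S \<Longrightarrow> u \<in> K \<Longrightarrow> v \<in> K \<Longrightarrow> snd u < snd t \<Longrightarrow> snd t < snd v \<Longrightarrow> t \<in> K"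
  unfolding block_def by blast

section \<open>Smallest blocks through two points\<close>

definition block_hull :: "point \<Rightarrow> point \<Rightarrow> point set \<Rightarrow> point set" where
  "block_hull u v T = \<Inter> {J. block T J \<and> u \<in> J \<and> v \<in> J}"

lemma block_hull_mem: "u \<in> block_hull u v T" "v \<in> block_hull u v T"
  by (auto simp: block_hull_def)

lemma block_hull_least: "block T J \<Longrightarrow> u \<in> J \<Longrightarrow> v \<in> J \<Longrightarrow> block_hull u v T \<subseteq> J"
  by (auto simp: block_hull_def)

lemma block_Inter: "\<J> \<noteq> {} \<Longrightarrow> (\<And>J. J \<in> \<J> \<Longrightarrow> block T J) \<Longrightarrow> block T (\<Inter> \<J>)"
  unfolding block_def by blast

text \<open>Both memberships make \<open>T\<close> itself a member of the intersected family. For a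
  point outside \<open>T\<close> the family is empty and the intersection is the whole
  plane.\<close>

lemma block_block_hull: "u \<in> T \<Longrightarrow> v \<in> T \<Longrightarrow> block T (block_hull u v T)"
  unfolding block_hull_def using block_self[of T] by (intro block_Inter) auto

text \<open>The points of \<open>I\<close> relate to every point outside \<open>I\<close> exactly as \<open>z\<close> does.\<close>

lemma block_expand:
  assumes gU: "generic U" and I: "block U I" and z: "z \<in> I" and W: "block (insert z (U - I)) W"
  shows "block U (if z \<in> W then W \<union> I else W)" (is "block U ?W'")
proof -
  let ?V = "insert z (U - I)"
  have IsU: "I \<subseteq> U" using I by (simp add: block_def)
  have WV: "W \<subseteq> ?V" using W by (simp add: block_def)
  have tw: "fst i < fst t \<longleftrightarrow> fst z < fst t" "snd i < snd t \<longleftrightarrow> snd z < snd t"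
    "fst t < fst i \<longleftrightarrow> fst t < fst z" "snd t < snd i \<longleftrightarrow> snd t < snd z"
    if "t \<in> U - I" "i \<in> I" for t i
  proof -
    have ne: "fst j \<noteq> fst t" "snd j \<noteq> snd t" if "j \<in> I" for j
      using generic_eqI[OF gU, of j t] that IsU \<open>t \<in> U - I\<close> by auto
    have "\<not> (fst i < fst t \<and> fst t < fst z)" "\<not> (fst z < fst t \<and> fst t < fst i)"
      "\<not> (snd i < snd t \<and> snd t < snd z)" "\<not> (snd z < snd t \<and> snd t < snd i)"
      using I(1) that z(1) unfolding block_def by blast+
    then show "fst i < fst t \<longleftrightarrow> fst z < fst t" "snd i < snd t \<longleftrightarrow> snd z < snd t"
      "fst t < fst i \<longleftrightarrow> fst t < fst z" "snd t < snd i \<longleftrightarrow> snd t < snd z"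
      using ne[OF that(2)] ne[OF z(1)] by auto
  qed
  have blk: "\<not> (fst p < fst t \<and> fst t < fst q) \<and> \<not> (snd p < snd t \<and> snd t < snd q)"
    if "t \<in> ?V - W" "p \<in> W" "q \<in> W" for t p q
    using W that unfolding block_def by blast
  show "block U ?W'"
    unfolding block_def
  proof (intro conjI ballI)
    show "?W' \<subseteq> U" using WV IsU z(1) by (auto split: if_splits)
    fix t p q assume t: "t \<in> U - ?W'" and p: "p \<in> ?W'" and q: "q \<in> ?W'"
    have "\<not> (fst p < fst t \<and> fst t < fst q) \<and> \<not> (snd p < snd t \<and> snd t < snd q)"
    proof (cases "z \<in> W")
      case True
      \<comment> \<open>Replacing every point of \<open>I\<close> by \<open>z\<close> preserves
        comparisons with \<open>t\<close> and moves \<open>p\<close> and \<open>q\<close> into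
        \<open>W\<close>, where the block property applies.\<close>
      define r where "r y = (if y \<in> I then z else y)" for y
      have tI: "t \<in> U - I" "t \<in> ?V - W" using t True by (auto split: if_splits)
      have r: "r p \<in> W" "r q \<in> W" using p q True by (auto simp: r_def)
      have "fst p < fst t \<longleftrightarrow> fst (r p) < fst t" "snd p < snd t \<longleftrightarrow> snd (r p) < snd t"
        "fst t < fst q \<longleftrightarrow> fst t < fst (r q)" "snd t < snd q \<longleftrightarrow> snd t < snd (r q)"
        using tw[OF tI(1)] by (auto simp: r_def)
      then show ?thesis using blk[OF tI(2) r] by simp
    next
      case False
      then have pq: "p \<in> W" "q \<in> W" "p \<in> U - I" "q \<in> U - I" and tW: "t \<notin> W"
        using p q t WV by (auto split: if_splits)
      show ?thesis
      proof (cases "t \<in> I")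
        case True
        \<comment> \<open>Here \<open>z\<close> stands in for \<open>t\<close>: it lies outside
          \<open>W\<close>, and \<open>p\<close> and \<open>q\<close> compare with \<open>z\<close>
          as they do with \<open>t\<close>.\<close>
        have "z \<in> ?V - W" using False by simp
        from blk[OF this pq(1,2)] show ?thesis
          using tw[OF pq(3) True] tw[OF pq(4) True] by simp
      next
        case F: False
        then show ?thesis using blk[of t p q] t tW pq by blast
      qed
    qed
    then show "\<not> (fst p < fst t \<and> fst t < fst q)" "\<not> (snd p < snd t \<and> snd t < snd q)"
      by auto
  qed
qed

section \<open>Simple point sets and the collapse of proper blocks\<close>

definition simple_points :: "point set \<Rightarrow> bool" where
  "simple_points U \<longleftrightarrow> (\<forall>I u v. block U I \<longrightarrow> u \<in> I \<longrightarrow> v \<in> I \<longrightarrow> u \<noteq> v \<longrightarrow> I = U)"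

text \<open>For \<open>S = U\<close> this amounts to \<open>simple_points U\<close>. The relative
  version is obtained first; collapsing blocks then keeps it while making \<open>U\<close>
  simple.\<close>

definition separates :: "point set \<Rightarrow> point set \<Rightarrow> bool" where
  "separates S U \<longleftrightarrow> S \<subseteq> U \<and>
     (\<forall>I u v. block U I \<longrightarrow> u \<in> S \<inter> I \<longrightarrow> v \<in> S \<inter> I \<longrightarrow> u \<noteq> v \<longrightarrow> I = U)"

lemma separatesI:
  assumes "S \<subseteq> U"
    and "\<And>I u v. block U I \<Longrightarrow> u \<in> S \<inter> I \<Longrightarrow> v \<in> S \<inter> I \<Longrightarrow> u \<noteq> v \<Longrightarrow> I = U"
  shows "separates S U"
  unfolding separates_def using assms by (intro conjI allI impI)

lemma separatesD:
  assumes "separates S U"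
  shows "S \<subseteq> U"
    and "block U I \<Longrightarrow> u \<in> S \<inter> I \<Longrightarrow> v \<in> S \<inter> I \<Longrightarrow> u \<noteq> v \<Longrightarrow> I = U"
  using assms unfolding separates_def by (rule conjunct1, elim conjE allE impE)

text \<open>The witness is the smallest block \<open>J\<close> of \<open>T\<close> containing
  \<open>S\<close>. A block of \<open>J\<close> is a block of \<open>T\<close>, so with two points
  of \<open>S\<close> it contains their hull, hence \<open>S\<close>, hence
  \<open>J\<close>.\<close>

lemma exists_separates:
  assumes "S \<subseteq> T"
    and "\<And>u v. u \<in> S \<Longrightarrow> v \<in> S \<Longrightarrow> u \<noteq> v \<Longrightarrow> S \<subseteq> block_hull u v T"
  shows "\<exists>U\<subseteq>T. separates S U"
proof -
  define J where "J = \<Inter> {J. block T J \<and> S \<subseteq> J}"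
  have J: "block T J" unfolding J_def
    by (rule block_Inter) (use assms(1) block_self[of T] in auto)
  have least: "J \<subseteq> I" if "block T I" "S \<subseteq> I" for I
    unfolding J_def by (rule Inter_lower) (use that in simp)
  have "separates S J"
  proof (rule separatesI)
    show "S \<subseteq> J" unfolding J_def by (rule Inter_greatest) simp
    fix I u v assume I: "block J I" "u \<in> S \<inter> I" "v \<in> S \<inter> I" "u \<noteq> v"
    have TI: "block T I" using J I(1) by (rule block_trans)
    have "block_hull u v T \<subseteq> I" by (rule block_hull_least[OF TI]) (use I in auto)
    moreover have "S \<subseteq> block_hull u v T" by (rule assms(2)) (use I in auto)
    ultimately have "J \<subseteq> I" using least[OF TI] by simp
    moreover have "I \<subseteq> J" using I(1) by (simp add: block_def)
    ultimately show "I = J" by simp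
  qed
  moreover have "J \<subseteq> T" using J by (simp add: block_def)
  ultimately show ?thesis by (intro exI[of _ J] conjI)
qed

text \<open>A proper block \<open>I\<close> has at most one point of \<open>S\<close>. Keeping a
  single point \<open>z\<close> of \<open>I\<close>, namely that one if it exists, preserves
  \<open>S\<close>, and \<open>block_expand\<close> turns blocks of the smaller set back into blocks
  of \<open>U\<close>.\<close>

lemma separates_collapse:
  assumes gU: "generic U" and sep: "separates S U"
    and I: "block U I" "u \<in> I" "v \<in> I" "u \<noteq> v" "I \<noteq> U"
  shows "\<exists>V\<subset>U. separates S V"
proof -
  have IsU: "I \<subseteq> U" using I(1) by (simp add: block_def)
  have one: "a = b" if "a \<in> S \<inter> I" "b \<in> S \<inter> I" for a b
    using separatesD(2)[OF sep I(1) that] I(5) by argo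
  obtain z where z: "z \<in> I" "S \<inter> I \<subseteq> {z}"
  proof (cases "S \<inter> I = {}")
    case True
    then show ?thesis using that[OF I(2)] by simp
  next
    case False
    then obtain z where "z \<in> S \<inter> I" by (metis ex_in_conv)
    then show ?thesis using that[of z] one by blast
  qed
  let ?V = "insert z (U - I)"
  have "separates S ?V"
  proof (rule separatesI)
    show "S \<subseteq> ?V" using separatesD(1)[OF sep] z(2) by auto
    fix W a b assume W: "block ?V W" "a \<in> S \<inter> W" "b \<in> S \<inter> W" "a \<noteq> b"
    have WV: "W \<subseteq> ?V" using W(1) by (simp add: block_def)
    have "(if z \<in> W then W \<union> I else W) = U"
      by (rule separatesD(2)[OF sep block_expand[OF gU I(1) z(1) W(1)] _ _ W(4)])
        (use W in auto)
    then show "W = ?V"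
      using WV I(5) IsU z(1) by (cases "z \<in> W") auto
  qed
  moreover have "?V \<subset> U"
  proof -
    obtain w where "w \<in> I" "w \<noteq> z" using I(2-4) by metis
    then show ?thesis using IsU z(1) by blast
  qed
  ultimately show ?thesis by (intro exI[of _ ?V] conjI)
qed

text \<open>Repeated collapsing terminates because each collapse removes a point from a finite
  set.\<close>

lemma exists_simple_between:
  assumes "generic U" "separates S U"
  shows "\<exists>V\<subseteq>U. S \<subseteq> V \<and> simple_points V"
  using assms
proof (induction "card U" arbitrary: U rule: less_induct)
  case less
  show ?case
  proof (cases "simple_points U")
    case True
    then show ?thesis using separatesD(1)[OF less.prems(2)] by blast
  next
    case False
    then obtain I u v where I: "block U I" "u \<in> I" "v \<in> I" "u \<noteq> v" "I \<noteq> U"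
      unfolding simple_points_def by blast
    obtain V where V: "V \<subset> U" "separates S V"
      using separates_collapse[OF less.prems I] by (elim exE conjE)
    have "card V < card U"
      using less.prems(1) V(1) by (intro psubset_card_mono) (simp_all add: generic_def)
    moreover have "generic V" using less.prems(1) V(1) by (intro generic_subset[of U V]) auto
    ultimately show ?thesis using less.hyps[of V] V by (meson order_trans psubset_imp_subset)
  qed
qed

text \<open>Supplies coordinates for new points: by density of the reals, \<open>h\<close> fits into
  the gap of \<open>X\<close> directly above \<open>a\<close>.\<close>

lemma real_just_above:
  fixes X :: "real set"
  assumes "finite X"
  shows "\<exists>h>a. \<forall>y\<in>X. a < y \<longrightarrow> h < y"
proof (cases "{y\<in>X. a < y} = {}")
  case True
  then show ?thesis by (intro exI[of _ "a + 1"]) auto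
next
  case False
  then have "a < Min {y\<in>X. a < y}" using assms by (subst Min_gr_iff) auto
  then obtain h where "a < h" "h < Min {y\<in>X. a < y}" using dense by blast
  then show ?thesis using assms False by (intro exI[of _ h]) (auto simp: Min_gr_iff)
qed

lemma real_just_below:
  fixes X :: "real set"
  assumes "finite X"
  shows "\<exists>h<a. \<forall>y\<in>X. y < a \<longrightarrow> y < h"
proof -
  obtain h where "h > -a" "\<forall>y\<in>uminus ` X. -a < y \<longrightarrow> h < y"
    using real_just_above[of "uminus ` X" "-a"] assms by auto
  then show ?thesis by (intro exI[of _ "-h"]) auto
qed

section \<open>Cutting a block by a new point\<close>

text \<open>
  \<open>L\<close>, \<open>M\<close>, \<open>R\<close> stand for containment of \<open>\<lambda>\<close>, \<open>\<mu>\<close>, \<open>\<rho>\<close>.  Keeping them abstract makes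
  the reverse-complement symmetry (\<open>L\<close> and \<open>R\<close> swapped, points negated) an instance of the
  same locale.
\<close>

locale three_parts =
  fixes L M R :: "point set \<Rightarrow> bool"
  assumes L_mono: "L A \<Longrightarrow> A \<subseteq> A' \<Longrightarrow> L A'"
    and R_mono: "R A \<Longrightarrow> A \<subseteq> A' \<Longrightarrow> R A'"
    and nonempty: "\<not> L {}" "\<not> M {}" "\<not> R {}"
begin

section \<open>Copies of the pattern and insertion of one point\<close>

definition has_MR :: "point set \<Rightarrow> bool" where
  "has_MR T \<longleftrightarrow> (\<exists>B C. B \<subseteq> T \<and> C \<subseteq> T \<and> below_left B C \<and> M B \<and> R C)"

definition has_LMR :: "point set \<Rightarrow> bool" where
  "has_LMR T \<longleftrightarrow> (\<exists>A B C. A \<subseteq> T \<and> B \<subseteq> T \<and> C \<subseteq> T \<and>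
     below_left A B \<and> below_left A C \<and> below_left B C \<and> L A \<and> M B \<and> R C)"

lemma has_MRI: "B \<subseteq> T \<Longrightarrow> C \<subseteq> T \<Longrightarrow> below_left B C \<Longrightarrow> M B \<Longrightarrow> R C \<Longrightarrow> has_MR T"
  unfolding has_MR_def by (intro exI conjI)

lemma has_LMRI:
  "A \<subseteq> T \<Longrightarrow> B \<subseteq> T \<Longrightarrow> C \<subseteq> T \<Longrightarrow> below_left A B \<Longrightarrow> below_left A C \<Longrightarrow> below_left B C \<Longrightarrow>
     L A \<Longrightarrow> M B \<Longrightarrow> R C \<Longrightarrow> has_LMR T"
  unfolding has_LMR_def by (intro exI conjI)

lemma has_MR_mono: "has_MR T \<Longrightarrow> T \<subseteq> T' \<Longrightarrow> has_MR T'"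
  unfolding has_MR_def by (meson subset_trans)

lemma has_LMR_mono: "has_LMR T \<Longrightarrow> T \<subseteq> T' \<Longrightarrow> has_LMR T'"
  unfolding has_LMR_def by (meson subset_trans)

lemma has_MR_nonempty: "has_MR T \<Longrightarrow> T \<noteq> {}"
  unfolding has_MR_def using nonempty by auto

text \<open>A copy using the new point has it either in the \<open>L\<close> part, with the other
  two parts at its upper right, or in one of the other parts, with the \<open>L\<close> part at its
  lower left. Both are excluded, so the copy lies in \<open>T\<close>.\<close>

lemma has_LMR_insert:
  assumes "has_LMR (insert (c, h) T)"
    and "\<not> has_MR {t\<in>T. c < fst t \<and> h < snd t}"
    and "\<not> L {t\<in>T. fst t < c \<and> snd t < h}"
  shows "has_LMR T"
proof -
  obtain A B C where ABC: "A \<subseteq> insert (c,h) T" "B \<subseteq> insert (c,h) T" "C \<subseteq> insert (c,h) T"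
    "below_left A B" "below_left A C" "below_left B C" "L A" "M B" "R C"
    using assms(1) unfolding has_LMR_def by (elim exE conjE)
  have "(c, h) \<notin> A"
  proof
    assume x: "(c, h) \<in> A"
    have up: "X \<subseteq> {t\<in>T. c < fst t \<and> h < snd t}"
      if X: "X \<subseteq> insert (c, h) T" "below_left A X" for X
    proof
      fix t assume t: "t \<in> X"
      have "c < fst t" "h < snd t" using X(2) x t unfolding below_left_def by fastforce+
      moreover have "t \<noteq> (c, h)" using \<open>c < fst t\<close> by auto
      ultimately show "t \<in> {t\<in>T. c < fst t \<and> h < snd t}" using X(1) t by blast
    qed
    show False using assms(2) has_MRI[OF up up] ABC by blast
  qed
  then have A: "A \<subseteq> T" using ABC(1) by blast
  have "(c, h) \<notin> X" if X: "below_left A X" for X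
  proof
    assume x: "(c, h) \<in> X"
    have "A \<subseteq> {t\<in>T. fst t < c \<and> snd t < h}"
    proof
      fix t assume t: "t \<in> A"
      then have "fst t < c" "snd t < h" using X x unfolding below_left_def by fastforce+
      then show "t \<in> {t\<in>T. fst t < c \<and> snd t < h}" using A t by blast
    qed
    then show False using assms(3) ABC(7) L_mono by blast
  qed
  then have "B \<subseteq> T" "C \<subseteq> T" using ABC(2-5) by blast+
  then show ?thesis using has_LMRI[OF A _ _ ABC(4-9)] by blast
qed

text \<open>
  On a vertical line \<open>x = c\<close>, the lowest gap whose upper right quadrant avoids \<open>M \<oplus> R\<close>
  can be filled: lowering it by one point \<open>p\<close> would produce \<open>M \<oplus> R\<close> above \<open>p\<close>, so the
  lower left quadrant avoids \<open>L\<close>.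
\<close>

lemma safe_height:
  assumes T: "generic T" "\<not> has_LMR T" and c: "c \<notin> fst ` T"
    and e: "e \<in> T"
    and D: "\<And>y. has_MR {t\<in>T. c < fst t \<and> y \<le> snd t} \<Longrightarrow> y < snd e"
  shows "\<exists>h < snd e. h \<notin> snd ` T \<and> \<not> has_LMR (insert (c, h) T)"
proof -
  have fin: "finite T" using T(1) by (simp add: generic_def)
  define D' where "D' = {y\<in>snd ` T. has_MR {t\<in>T. c < fst t \<and> y \<le> snd t}}"
  have finD: "finite D'" unfolding D'_def using fin by simp
  \<comment> \<open>A copy strictly above \<open>b\<close> lies weakly above the next height of
    \<open>T\<close>, and that height belongs to \<open>D'\<close>.\<close>
  have ex_D: "\<exists>y\<in>D'. y > b" if MRb: "has_MR {t\<in>T. c < fst t \<and> b < snd t}" for b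
  proof -
    let ?Y = "{y\<in>snd ` T. b < y}"
    obtain t where "t \<in> T" "b < snd t" using has_MR_nonempty[OF MRb] by blast
    then have "?Y \<noteq> {}" by blast
    then have Min: "Min ?Y \<in> ?Y" using fin by (intro Min_in) simp_all
    have Min_le: "Min ?Y \<le> y" if "y \<in> ?Y" for y using fin that by (intro Min_le) simp_all
    have "{t\<in>T. c < fst t \<and> b < snd t} \<subseteq> {t\<in>T. c < fst t \<and> Min ?Y \<le> snd t}"
      using Min_le by blast
    then have "Min ?Y \<in> D'"
      using Min has_MR_mono[OF MRb] by (simp add: D'_def)
    with Min show ?thesis by blast
  qed
  show ?thesis
  proof (cases "D' = {}")
    case True
    \<comment> \<open>Without any critical height the new point can go below all of
      \<open>T\<close>, where its lower left quadrant is empty.\<close>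
    define h where "h = Min (snd ` T) - 1"
    have h: "h < snd t" if "t \<in> T" for t
    proof -
      have "Min (snd ` T) \<le> snd t" using fin that by simp
      then show ?thesis by (simp add: h_def)
    qed
    have nMR: "\<not> has_MR {t\<in>T. c < fst t \<and> h < snd t}" using ex_D True by blast
    have "{t\<in>T. fst t < c \<and> snd t < h} = {}" using h order.asym by blast
    then have "\<not> L {t\<in>T. fst t < c \<and> snd t < h}" using nonempty(1) by metis
    then have "\<not> has_LMR (insert (c, h) T)" using has_LMR_insert[OF _ nMR] T(2) by blast
    moreover have "h < snd e" using h e by blast
    moreover have "h \<notin> snd ` T" using h by blast
    ultimately show ?thesis by blast
  next
    case False
    \<comment> \<open>The new point goes just above \<open>d\<close>, the greatest height whose
      closed quadrant still holds a copy; the open quadrant above \<open>d\<close> holds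
      none.\<close>
    define d where "d = Max D'"
    have d: "d \<in> D'" "\<And>y. y \<in> D' \<Longrightarrow> y \<le> d"
      unfolding d_def using False finD by auto
    have MRd: "has_MR {t\<in>T. c < fst t \<and> d \<le> snd t}" using d(1) by (simp add: D'_def)
    have noMR: "\<not> has_MR {t\<in>T. c < fst t \<and> d < snd t}" using ex_D d(2) not_less by blast
    obtain h where h: "h > d" "\<And>t. t \<in> T \<Longrightarrow> d < snd t \<Longrightarrow> h < snd t"
      using real_just_above[of "snd ` T" d] fin by auto
    obtain q where q: "q \<in> T" "snd q = d" using d(1) by (auto simp: D'_def)
    \<comment> \<open>By genericity \<open>q\<close> is the only point at height \<open>d\<close>.
      If it were not right of the line, the closed and the open quadrant would coincide.\<close>
    have qc: "c < fst q"
    proof (rule ccontr)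
      assume "\<not> c < fst q"
      then have "{t\<in>T. c < fst t \<and> d \<le> snd t} \<subseteq> {t\<in>T. c < fst t \<and> d < snd t}"
        using generic_eqI[OF T(1) _ q(1)] q(2) by fastforce
      then show False using noMR has_MR_mono[OF MRd] by blast
    qed
    have "{t\<in>T. c < fst t \<and> h < snd t} \<subseteq> {t\<in>T. c < fst t \<and> d < snd t}" using h(1) by auto
    then have nMR: "\<not> has_MR {t\<in>T. c < fst t \<and> h < snd t}" using noMR has_MR_mono by blast
    have "\<not> L {t\<in>T. fst t < c \<and> snd t < h}"
    proof
      assume LL: "L {t\<in>T. fst t < c \<and> snd t < h}"
      \<comment> \<open>No height of \<open>T\<close> lies between \<open>d\<close> and
        \<open>h\<close>, and the only point at height \<open>d\<close> is \<open>q\<close>, right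
        of the line. So the lower left points lie strictly below the copy found at \<open>d\<close>,
        and a copy of \<open>L\<close> among them would complete the pattern in
        \<open>T\<close>.\<close>
      have "snd t < d" if "t \<in> T" "fst t < c" "snd t < h" for t
      proof (rule ccontr)
        assume "\<not> snd t < d"
        then consider "snd t = d" | "snd t > d" by linarith
        then show False
        proof cases
          case 1
          then show False using generic_eqI[OF T(1) that(1) q(1)] q qc that by auto
        next
          case 2
          then show False using h(2)[OF that(1)] that(3) by simp
        qed
      qed
      then have low: "below_left {t\<in>T. fst t < c \<and> snd t < h} {t\<in>T. c < fst t \<and> d \<le> snd t}"
        unfolding below_left_def by force
      obtain B C where BC: "B \<subseteq> {t\<in>T. c < fst t \<and> d \<le> snd t}"
        "C \<subseteq> {t\<in>T. c < fst t \<and> d \<le> snd t}" "below_left B C" "M B" "R C"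
        using MRd unfolding has_MR_def by (elim exE conjE)
      have "has_LMR T"
      proof (rule has_LMRI[OF _ _ _ _ _ BC(3) LL BC(4,5)])
        show "B \<subseteq> T" "C \<subseteq> T" using BC by auto
      qed (use below_left_mono[OF low] BC in auto)
      then show False using T(2) by blast
    qed
    then have "\<not> has_LMR (insert (c, h) T)" using has_LMR_insert[OF _ nMR] T(2) by blast
    moreover have "d < snd e" using D MRd by blast
    then have "h < snd e" using h(2) e by blast
    moreover have "h \<notin> snd ` T"
    proof
      assume "h \<in> snd ` T"
      then obtain t where t: "t \<in> T" "h = snd t" by blast
      show False using h(1) h(2)[OF t(1)] t(2) by simp
    qed
    ultimately show ?thesis by blast
  qed
qed

text \<open>The last clause drives the induction in \<open>separate_pair\<close>: a hull containing
  \<open>K\<close> swallows the new point together with a point of \<open>T\<close> outside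
  \<open>K\<close>, so fewer points stay outside.\<close>

definition cuts_block :: "point set \<Rightarrow> point set \<Rightarrow> point \<Rightarrow> bool" where
  "cuts_block T K x \<longleftrightarrow> generic (insert x T) \<and> x \<notin> T \<and> \<not> has_LMR (insert x T) \<and>
     (\<forall>J. block (insert x T) J \<longrightarrow> K \<subseteq> J \<longrightarrow> x \<in> J \<and> \<not> J \<inter> T \<subseteq> K)"

lemma cuts_blockD:
  assumes "cuts_block T K x"
  shows "generic (insert x T)" "x \<notin> T" "\<not> has_LMR (insert x T)"
    and "block (insert x T) J \<Longrightarrow> K \<subseteq> J \<Longrightarrow> x \<in> J \<and> \<not> J \<inter> T \<subseteq> K"
  using assms unfolding cuts_block_def by blast+

text \<open>
  The vertical line runs just left of the rightmost point of \<open>K\<close>.  Hence right of the line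
  and not below the highest point \<open>e\<close> under \<open>K\<close>, only one point of \<open>K\<close> is left, and \<open>M \<oplus> R\<close>
  there puts \<open>R\<close> entirely above and to the right of \<open>K\<close>.
\<close>

lemma cut_below:
  assumes T: "generic T" "\<not> has_LMR T"
    and K: "block T K" "u \<in> K" "v \<in> K" "u \<noteq> v"
    and ex: "\<exists>t\<in>T. \<forall>k\<in>K. snd t < snd k"
    and LR: "L {t\<in>T. \<forall>k\<in>K. fst t < fst k \<and> snd t < snd k} \<or>
             \<not> R {t\<in>T. \<forall>k\<in>K. fst k < fst t \<and> snd k < snd t}"
  shows "\<exists>x. cuts_block T K x"
proof -
  have fin: "finite T" using T(1) by (simp add: generic_def)
  have KT: "K \<subseteq> T" using K(1) by (simp add: block_def)
  have finK: "finite K" using KT fin finite_subset by blast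
  have "Max (fst ` K) \<in> fst ` K" using finK K(2) by (intro Max_in) auto
  then obtain f where f: "Max (fst ` K) = fst f" "f \<in> K" by (rule imageE)
  have fmax: "fst k \<le> fst f" if "k \<in> K" for k
    unfolding f(1)[symmetric] using finK that by (intro Max_ge) auto
  \<comment> \<open>No point of \<open>T\<close> has its first coordinate in the gap from
    \<open>c\<close> to \<open>fst f\<close>; in particular every point of \<open>K\<close> except
    \<open>f\<close> is left of the line.\<close>
  obtain c where c: "c < fst f" "\<And>t. t \<in> T \<Longrightarrow> fst t < fst f \<Longrightarrow> fst t < c"
    using real_just_below[of "fst ` T" "fst f"] fin by auto
  have cr: "fst f \<le> fst t" if "t \<in> T" "c < fst t" for t using c(2)[OF that(1)] that(2) by force
  have cn: "c \<notin> fst ` T" using c by force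
  obtain g where g: "g \<in> K" "fst g < c"
  proof -
    obtain g where "g \<in> K" "g \<noteq> f" using K(2-4) by metis
    then have "fst g < fst f" using fmax[of g] generic_eqI[OF T(1), of g f] KT f(2) by force
    then show ?thesis using that c(2) KT \<open>g \<in> K\<close> by blast
  qed
  let ?B = "{t\<in>T. \<forall>k\<in>K. snd t < snd k}"
  have "?B \<noteq> {}" using ex by blast
  then have "Max (snd ` ?B) \<in> snd ` ?B" using fin by (intro Max_in) simp_all
  then obtain e where e: "Max (snd ` ?B) = snd e" "e \<in> ?B" by (rule imageE)
  have emax: "snd t \<le> snd e" if "t \<in> ?B" for t
    unfolding e(1)[symmetric] using fin that by (intro Max_ge) auto
  have D: "y < snd e" if "has_MR {t\<in>T. c < fst t \<and> y \<le> snd t}" for y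
  proof (rule ccontr)
    assume "\<not> y < snd e"
    then have "{t\<in>T. c < fst t \<and> y \<le> snd t} \<subseteq> {t\<in>T. c < fst t \<and> snd e \<le> snd t}" by auto
    then have "has_MR {t\<in>T. c < fst t \<and> snd e \<le> snd t}" using has_MR_mono that by blast
    then obtain B C where BC: "B \<subseteq> {t\<in>T. c < fst t \<and> snd e \<le> snd t}"
      "C \<subseteq> {t\<in>T. c < fst t \<and> snd e \<le> snd t}" "below_left B C" "M B" "R C"
      unfolding has_MR_def by (elim exE conjE)
    show False using LR
    proof
      \<comment> \<open>Points of \<open>?P\<close> are left of the line and, being below
        \<open>K\<close>, no higher than \<open>e\<close>. Their copy of \<open>L\<close> would
        therefore extend the copy given by \<open>B\<close> and \<open>C\<close> to the whole
        pattern.\<close>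
      let ?P = "{t\<in>T. \<forall>k\<in>K. fst t < fst k \<and> snd t < snd k}"
      assume LP: "L ?P"
      have "fst p < fst b \<and> snd p < snd b"
        if p: "p \<in> ?P" and b: "b \<in> {t\<in>T. c < fst t \<and> snd e \<le> snd t}" for p b
      proof -
        have "fst p < c" using p c(2) f(2) by blast
        then have 1: "fst p < fst b" using b by simp
        have "snd p \<le> snd e" using emax p by blast
        moreover have "snd p \<noteq> snd b" using 1 generic_eqI[OF T(1), of p b] p b by auto
        ultimately show ?thesis using 1 b by auto
      qed
      then have "below_left ?P {t\<in>T. c < fst t \<and> snd e \<le> snd t}"
        unfolding below_left_def by blast
      note low = below_left_mono[OF this subset_refl]
      have "has_LMR T"
      proof (rule has_LMRI[OF _ _ _ _ _ BC(3) LP BC(4,5)])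
        show "B \<subseteq> T" "C \<subseteq> T" using BC by auto
      qed (use low BC in auto)
      then show False using T(2) by blast
    next
      let ?Q = "{t\<in>T. \<forall>k\<in>K. fst k < fst t \<and> snd k < snd t}"
      assume nR: "\<not> R ?Q"
      \<comment> \<open>The point \<open>b\<close> forces every point of \<open>C\<close> strictly
        right of \<open>f\<close> and strictly above \<open>e\<close>. Such a point is not in
        \<open>K\<close> and not below all of \<open>K\<close>, so the block property puts it above
        \<open>K\<close>.\<close>
      obtain b where b: "b \<in> B" using BC(4) nonempty(2) by (metis equals0I)
      have "z \<in> ?Q" if z: "z \<in> C" for z
      proof -
        have bz: "fst b < fst z" "snd b < snd z" using BC(3) b z by (auto simp: below_left_def)
        have bT: "b \<in> T" "c < fst b" "snd e \<le> snd b" and zT: "z \<in> T" using BC b z by auto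
        have fz: "fst f < fst z" using cr[OF bT(1,2)] bz by simp
        then have zK: "z \<notin> K" using fmax by fastforce
        have "z \<notin> ?B" using emax[of z] bz bT by auto
        then obtain k where k: "k \<in> K" "snd k \<le> snd z" using zT by fastforce
        have ne: "snd k' \<noteq> snd z" if "k' \<in> K" for k'
          using generic_eqI[OF T(1), of k' z] KT that zT zK by auto
        have "snd k' < snd z" if k': "k' \<in> K" for k'
          using blockD_snd[OF K(1) zT k(1) k'] ne[OF k'] ne[OF k(1)] k(2) zK by force
        moreover have "fst k' < fst z" if "k' \<in> K" for k' using fmax[OF that] fz by simp
        ultimately show ?thesis using zT by blast
      qed
      then have "C \<subseteq> ?Q" by blast
      then show False using R_mono BC(5) nR by blast
    qed
  qed
  have eT: "e \<in> T" using e by simp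
  obtain h where h: "h < snd e" "h \<notin> snd ` T" "\<not> has_LMR (insert (c, h) T)"
    using safe_height[OF T cn eT D] by blast
  \<comment> \<open>The new point lies horizontally between \<open>g\<close> and \<open>f\<close>,
    so it joins any block containing \<open>K\<close>. Then \<open>e\<close> lies vertically between
    it and \<open>f\<close>, so \<open>e\<close> joins as well.\<close>
  have "x \<in> J \<and> \<not> J \<inter> T \<subseteq> K"
    if J: "block (insert (c, h) T) J" "K \<subseteq> J" and x: "x = (c, h)" for J x
  proof -
    have "x \<in> J" using blockD_fst[OF J(1), of x g f] x J(2) g f c by auto
    moreover have "snd e < snd f" using e f by blast
    then have "e \<in> J" using blockD_snd[OF J(1), of e x f] \<open>x \<in> J\<close> x h eT f J(2) by auto
    moreover have "e \<notin> K" using e by blast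
    ultimately show ?thesis using eT by blast
  qed
  moreover have "generic (insert (c, h) T)"
    using T(1) cn h(2) by (auto simp: generic_def)
  moreover have "(c, h) \<notin> T" using cn by force
  ultimately have "cuts_block T K (c, h)" unfolding cuts_block_def using h(3) by blast
  then show ?thesis ..
qed

end

section \<open>Symmetry under negation of points\<close>

lemma mem_uminus_image: "t \<in> uminus ` X \<longleftrightarrow> - t \<in> X" for t :: point
  by (metis imageE imageI minus_minus)

lemma generic_uminus: "generic (uminus ` T) \<longleftrightarrow> generic T"
  by (auto simp: generic_def inj_on_def finite_image_iff)

lemma below_left_uminus: "below_left (uminus ` A) (uminus ` B) \<longleftrightarrow> below_left B A"
  by (auto simp: below_left_def)

lemma block_uminus:
  assumes "block T K"
  shows "block (uminus ` T) (uminus ` K)"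
proof -
  have "uminus ` T - uminus ` K = uminus ` (T - K)"
    by (simp add: image_set_diff)
  then show ?thesis using assms unfolding block_def by (simp add: image_mono) blast
qed

lemma uminus_image_image [simp]: "uminus ` uminus ` T = (T :: point set)"
  by (simp add: image_image)

context three_parts begin

lemma reversed: "three_parts (\<lambda>S. R (uminus ` S)) (\<lambda>S. M (uminus ` S)) (\<lambda>S. L (uminus ` S))"
proof
  fix A A' :: "point set"
  assume "A \<subseteq> A'"
  then have "uminus ` A \<subseteq> uminus ` A'" by (rule image_mono)
  then show "R (uminus ` A) \<Longrightarrow> R (uminus ` A')"
    "L (uminus ` A) \<Longrightarrow> L (uminus ` A')"
    using L_mono R_mono by blast+
qed (simp_all add: nonempty)

lemma has_LMR_uminus:
  "three_parts.has_LMR (\<lambda>S. R (uminus ` S)) (\<lambda>S. M (uminus ` S)) (\<lambda>S. L (uminus ` S)) (uminus ` T)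
     \<longleftrightarrow> has_LMR T" (is "?A \<longleftrightarrow> _")
proof
  assume ?A
  then obtain A B C where ABC: "A \<subseteq> uminus ` T" "B \<subseteq> uminus ` T" "C \<subseteq> uminus ` T"
    "below_left A B" "below_left A C" "below_left B C"
    "R (uminus ` A)" "M (uminus ` B)" "L (uminus ` C)"
    unfolding three_parts.has_LMR_def[OF reversed] by (elim exE conjE)
  have "uminus ` X \<subseteq> T" if "X \<subseteq> uminus ` T" for X
    using image_mono[OF that, of uminus] by simp
  then show "has_LMR T"
    by (intro has_LMRI[of "uminus ` C" _ "uminus ` B" "uminus ` A"])
      (use ABC in \<open>simp_all add: below_left_uminus\<close>)
next
  assume "has_LMR T"
  then obtain A B C where ABC: "A \<subseteq> T" "B \<subseteq> T" "C \<subseteq> T"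
    "below_left A B" "below_left A C" "below_left B C" "L A" "M B" "R C"
    unfolding has_LMR_def by (elim exE conjE)
  then show ?A
    by (intro three_parts.has_LMRI[OF reversed, of "uminus ` C" _ "uminus ` B" "uminus ` A"])
      (simp_all add: below_left_uminus image_mono)
qed

text \<open>The mirror image of \<open>cut_below\<close>, which is applied to the negated set in the
  reversed locale; the point found there is negated back.\<close>

lemma cut_above:
  assumes T: "generic T" "\<not> has_LMR T"
    and K: "block T K" "u \<in> K" "v \<in> K" "u \<noteq> v"
    and ex: "\<exists>t\<in>T. \<forall>k\<in>K. snd k < snd t"
    and LR: "R {t\<in>T. \<forall>k\<in>K. fst k < fst t \<and> snd k < snd t} \<or>
             \<not> L {t\<in>T. \<forall>k\<in>K. fst t < fst k \<and> snd t < snd k}"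
  shows "\<exists>x. cuts_block T K x"
proof -
  interpret r: three_parts "\<lambda>S. R (uminus ` S)" "\<lambda>S. M (uminus ` S)" "\<lambda>S. L (uminus ` S)"
    by (rule reversed)
  have eq: "uminus ` {t \<in> uminus ` T. \<forall>k\<in>uminus ` K. P t k} = {t\<in>T. \<forall>k\<in>K. P (- t) (- k)}"
    for P :: "point \<Rightarrow> point \<Rightarrow> bool" by (rule set_eqI) (simp add: mem_uminus_image)
  have "\<exists>x. r.cuts_block (uminus ` T) (uminus ` K) x"
  proof (rule r.cut_below)
    show "generic (uminus ` T)" using T by (simp add: generic_uminus)
    show "\<not> r.has_LMR (uminus ` T)" using T by (simp add: has_LMR_uminus)
    show "block (uminus ` T) (uminus ` K)" using K by (simp add: block_uminus)
    show "- u \<in> uminus ` K" "- v \<in> uminus ` K" "- u \<noteq> - v" using K by auto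
    show "\<exists>t\<in>uminus ` T. \<forall>k\<in>uminus ` K. snd t < snd k" using ex by auto
  qed (use LR in \<open>simp only: eq fst_uminus snd_uminus neg_less_iff_less\<close>)
  then obtain x where x: "r.cuts_block (uminus ` T) (uminus ` K) x" ..
  have ins: "insert x (uminus ` T) = uminus ` insert (- x) T" by simp
  have "cuts_block T K (- x)" unfolding cuts_block_def
  proof (intro conjI allI impI)
    show "generic (insert (- x) T)"
      using r.cuts_blockD(1)[OF x] unfolding ins generic_uminus .
    show "- x \<notin> T" using r.cuts_blockD(2)[OF x] unfolding mem_uminus_image .
    show "\<not> has_LMR (insert (- x) T)"
      using r.cuts_blockD(3)[OF x] unfolding ins has_LMR_uminus .
    fix J assume J: "block (insert (- x) T) J" "K \<subseteq> J"
    have "block (insert x (uminus ` T)) (uminus ` J)"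
      unfolding ins using J(1) by (rule block_uminus)
    note * = r.cuts_blockD(4)[OF x this image_mono[OF J(2)]]
    show "- x \<in> J" using conjunct1[OF *] unfolding mem_uminus_image .
    show "\<not> J \<inter> T \<subseteq> K"
    proof
      assume sub: "J \<inter> T \<subseteq> K"
      have "uminus ` J \<inter> uminus ` T \<subseteq> uminus ` K"
      proof
        fix t assume "t \<in> uminus ` J \<inter> uminus ` T"
        then have "- t \<in> J \<inter> T" unfolding Int_iff mem_uminus_image .
        with sub show "t \<in> uminus ` K" unfolding mem_uminus_image by (rule subsetD)
      qed
      with conjunct2[OF *] show False by (rule notE)
    qed
  qed
  then show ?thesis ..
qed

text \<open>An outside point lies below or above all of \<open>K\<close>. If
  \<open>cut_below\<close> does not apply, then either nothing lies below \<open>K\<close>, so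
  \<open>?P\<close> is empty and \<open>L ?P\<close> fails, or \<open>R ?Q\<close> holds, which
  itself supplies a point above \<open>K\<close>. Either way \<open>cut_above\<close>
  applies.\<close>

lemma cut_exists:
  assumes T: "generic T" "\<not> has_LMR T"
    and K: "block T K" "u \<in> K" "v \<in> K" "u \<noteq> v" "K \<noteq> T"
  shows "\<exists>x. cuts_block T K x"
proof -
  let ?P = "{t\<in>T. \<forall>k\<in>K. fst t < fst k \<and> snd t < snd k}"
  let ?Q = "{t\<in>T. \<forall>k\<in>K. fst k < fst t \<and> snd k < snd t}"
  have KT: "K \<subseteq> T" using K(1) by (simp add: block_def)
  obtain t where t: "t \<in> T" "t \<notin> K" using K(5) KT by blast
  have ne: "snd k \<noteq> snd t" if "k \<in> K" for k
    using generic_eqI[OF T(1), of k t] KT that t by auto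
  have side: "(\<forall>k\<in>K. snd t < snd k) \<or> (\<forall>k\<in>K. snd k < snd t)"
    using blockD_snd[OF K(1) t(1)] t(2) ne by (metis linorder_neqE_linordered_idom)
  have QT: "?Q \<noteq> {}" if "R ?Q" using that nonempty by metis
  have PT: "?P \<noteq> {}" if "L ?P" using that nonempty by metis
  show ?thesis
  proof (cases "(\<exists>t\<in>T. \<forall>k\<in>K. snd t < snd k) \<and> (L ?P \<or> \<not> R ?Q)")
    case True
    then show ?thesis using cut_below[OF T K(1-4)] by blast
  next
    case False
    then have "(\<exists>t\<in>T. \<forall>k\<in>K. snd k < snd t) \<and> (R ?Q \<or> \<not> L ?P)"
      using side t(1) QT PT by blast
    then show ?thesis using cut_above[OF T K(1-4)] by blast
  qed
qed

section \<open>Separating all pairs of points\<close>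

lemma separate_pair:
  assumes "generic T" "\<not> has_LMR T" "u \<in> T" "v \<in> T" "u \<noteq> v"
  shows "\<exists>T'. T \<subseteq> T' \<and> generic T' \<and> \<not> has_LMR T' \<and> block_hull u v T' = T'"
  using assms(1-4)
proof (induction "card (T - block_hull u v T)" arbitrary: T rule: less_induct)
  case less
  note T = less.prems(1,2) and uv = less.prems(3,4)
  show ?case
  proof (cases "block_hull u v T = T")
    case True
    with T show ?thesis by blast
  next
    case False
    obtain x where x: "cuts_block T (block_hull u v T) x"
      using cut_exists[OF T block_block_hull block_hull_mem(1) block_hull_mem(2) assms(5) False] uv by blast
    let ?T = "insert x T"
    have uv': "u \<in> ?T" "v \<in> ?T" using uv by auto
    \<comment> \<open>Restricted to \<open>T\<close>, the new hull is a block of \<open>T\<close>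
      through \<open>u\<close> and \<open>v\<close>. It thus contains the old hull, and the last
      clause of \<open>cuts_block\<close> becomes available.\<close>
    have "block T (block_hull u v ?T \<inter> T)"
      by (rule block_restrict[OF block_block_hull]) (use uv' in auto)
    then have sub: "block_hull u v T \<subseteq> block_hull u v ?T \<inter> T"
      by (rule block_hull_least) (use uv block_hull_mem in auto)
    then have J: "x \<in> block_hull u v ?T \<and> \<not> block_hull u v ?T \<inter> T \<subseteq> block_hull u v T"
      using cuts_blockD(4)[OF x block_block_hull[OF uv']] by simp
    have "finite T" using T(1) by (simp add: generic_def)
    \<comment> \<open>Enlarging \<open>T\<close> does not raise the count, since \<open>x\<close> is
      inside the new hull.\<close>
    moreover have "?T - block_hull u v ?T \<subset> T - block_hull u v T" using J sub by blast
    ultimately have "card (?T - block_hull u v ?T) < card (T - block_hull u v T)"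
      by (intro psubset_card_mono) simp_all
    from less.hyps[OF this cuts_blockD(1,3)[OF x] uv'] show ?thesis by (meson insert_subset)
  qed
qed

text \<open>Only \<open>S\<close> is required to lie in each hull, because this survives later
  insertions: hulls grow with \<open>T\<close>, whereas a hull equal to \<open>T\<close> need not
  equal the enlarged set.\<close>

lemma separate_pairs:
  assumes "generic S" "\<not> has_LMR S" "finite Z" "Z \<subseteq> {(u, v). u \<in> S \<and> v \<in> S \<and> u \<noteq> v}"
  shows "\<exists>T. S \<subseteq> T \<and> generic T \<and> \<not> has_LMR T \<and> (\<forall>(u, v)\<in>Z. S \<subseteq> block_hull u v T)"
  using assms(3,4)
proof (induction Z rule: finite_induct)
  case empty
  then show ?case using assms(1,2) by (intro exI[of _ S]) simp
next
  case (insert p Z)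
  obtain u v where p: "p = (u, v)" by (cases p)
  obtain T where T: "S \<subseteq> T" "generic T" "\<not> has_LMR T"
    and old: "\<forall>(u, v)\<in>Z. S \<subseteq> block_hull u v T"
    using insert.IH insert.prems by auto
  have uv: "u \<in> S" "v \<in> S" "u \<noteq> v" using insert.prems p by auto
  obtain T' where T': "T \<subseteq> T'" "generic T'" "\<not> has_LMR T'" and new: "block_hull u v T' = T'"
    using separate_pair[OF T(2,3) _ _ uv(3)] uv(1,2) T(1) by blast
  have "\<forall>(a, b)\<in>Z. S \<subseteq> block_hull a b T'"
  proof clarify
    fix a b t assume ab: "(a, b) \<in> Z" "t \<in> S"
    have abS: "a \<in> T" "b \<in> T" using insert.prems ab(1) T(1) by auto
    then have "block T (block_hull a b T' \<inter> T)"
      using T'(1) by (intro block_restrict[OF block_block_hull]) auto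
    then have "block_hull a b T \<subseteq> block_hull a b T' \<inter> T"
      by (rule block_hull_least) (use abS block_hull_mem in auto)
    then show "t \<in> block_hull a b T'" using old ab by blast
  qed
  moreover have "S \<subseteq> block_hull u v T'" using new T(1) T'(1) by simp
  ultimately show ?case using T(1) T' p by (intro exI[of _ T']) simp
qed

lemma exists_simple_superset:
  assumes S: "generic S" "\<not> has_LMR S"
  shows "\<exists>U. S \<subseteq> U \<and> generic U \<and> \<not> has_LMR U \<and> simple_points U"
proof -
  have "finite {(u, v). u \<in> S \<and> v \<in> S \<and> u \<noteq> v}"
    using S(1) by (auto simp: generic_def intro: finite_subset[of _ "S \<times> S"])
  from separate_pairs[OF S this subset_refl]
  obtain T where T: "S \<subseteq> T" "generic T" "\<not> has_LMR T"
    and sep: "\<forall>(u, v)\<in>{(u, v). u \<in> S \<and> v \<in> S \<and> u \<noteq> v}. S \<subseteq> block_hull u v T"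
    by (elim exE conjE)
  have "\<exists>U\<subseteq>T. separates S U"
    by (rule exists_separates[OF T(1)]) (use sep in blast)
  then obtain U where U: "U \<subseteq> T" "separates S U" by (elim exE conjE)
  have gU: "generic U" using T(2) U(1) by (rule generic_subset)
  obtain V where V: "V \<subseteq> U" "S \<subseteq> V" "simple_points V"
    using exists_simple_between[OF gU U(2)] by (elim exE conjE)
  have "\<not> has_LMR V"
  proof
    assume "has_LMR V"
    then have "has_LMR T" by (rule has_LMR_mono) (use V(1) U(1) in simp)
    with T(3) show False by (rule notE)
  qed
  moreover have "generic V" using gU V(1) by (rule generic_subset)
  ultimately show ?thesis using V by (intro exI[of _ V]) simp
qed

end

section \<open>Permutations as point sets\<close>

text \<open>Containment phrased without listing the points, so that it is monotone in the set and
  can serve as \<open>L\<close>, \<open>M\<close> and \<open>R\<close>.\<close>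

definition occurs :: "nat list \<Rightarrow> point set \<Rightarrow> bool" where
  "occurs q S \<longleftrightarrow> (\<exists>f. (\<forall>i<length q. f i \<in> S) \<and>
     (\<forall>j<length q. \<forall>i<j. fst (f i) < fst (f j)) \<and>
     (\<forall>i<length q. \<forall>j<length q. q ! i < q ! j \<longleftrightarrow> snd (f i) < snd (f j)))"

definition represents :: "nat list \<Rightarrow> point list \<Rightarrow> point set \<Rightarrow> bool" where
  "represents p l S \<longleftrightarrow> length p = length l \<and> set l = S \<and>
     (\<forall>j<length l. \<forall>i<j. fst (l ! i) < fst (l ! j)) \<and>
     (\<forall>i<length l. \<forall>j<length l. p ! i < p ! j \<longleftrightarrow> snd (l ! i) < snd (l ! j))"

lemma occurs_mono:
  assumes "occurs q A" "A \<subseteq> B"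
  shows "occurs q B"
proof -
  obtain f where f: "\<forall>i<length q. f i \<in> A" "\<forall>j<length q. \<forall>i<j. fst (f i) < fst (f j)"
    "\<forall>i<length q. \<forall>j<length q. q ! i < q ! j \<longleftrightarrow> snd (f i) < snd (f j)"
    using assms(1) unfolding occurs_def by (elim exE conjE)
  have "\<forall>i<length q. f i \<in> B" using f(1) assms(2) by blast
  then show ?thesis unfolding occurs_def using f(2,3) by (intro exI[of _ f] conjI)
qed

lemma occurs_empty: "occurs q {} \<longleftrightarrow> q = []"
  by (auto simp: occurs_def)

section \<open>Subsequences as increasing index maps\<close>

lemma subseq_imp_indices:
  "subseq s b \<Longrightarrow> \<exists>g. (\<forall>i<length s. g i < length b \<and> s ! i = b ! g i) \<and>
     (\<forall>j<length s. \<forall>i<j. g i < (g j :: nat))"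
proof (induction rule: list_emb.induct)
  case (list_emb_Nil ys)
  then show ?case by simp
next
  case (list_emb_Cons xs ys y)
  then obtain g where g: "\<forall>i<length xs. g i < length ys \<and> xs ! i = ys ! g i"
    "\<forall>j<length xs. \<forall>i<j. g i < (g j :: nat)" by (elim exE conjE)
  then show ?case by (intro exI[of _ "\<lambda>i. Suc (g i)"]) simp
next
  case (list_emb_Cons2 x y xs ys)
  then obtain g where g: "\<forall>i<length xs. g i < length ys \<and> xs ! i = ys ! g i"
    "\<forall>j<length xs. \<forall>i<j. g i < (g j :: nat)" by (elim exE conjE)
  let ?g = "case_nat 0 (\<lambda>k. Suc (g k))"
  have "?g i < length (y # ys) \<and> (x # xs) ! i = (y # ys) ! ?g i" if "i < length (x # xs)" for i
    using that g(1) list_emb_Cons2.hyps(1) by (cases i) simp_all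
  moreover have "?g i < ?g j" if "j < length (x # xs)" "i < j" for i j
    using that g(2) by (cases i; cases j) simp_all
  ultimately show ?case by (intro exI[of _ ?g]) simp
qed

lemma subseq_indicesI:
  assumes "\<And>i. i < length s \<Longrightarrow> g i < length b \<and> s ! i = b ! g i"
    and "\<And>i j. i < j \<Longrightarrow> j < length s \<Longrightarrow> g i < (g j :: nat)"
  shows "subseq s b"
  using assms
proof (induction b arbitrary: s g)
  case Nil
  then show ?case using Nil(1)[of 0] by (cases s) simp_all
next
  case (Cons y b)
  show ?case
  proof (cases s)
    case Nil
    then show ?thesis by simp
  next
    case s: (Cons x xs)
    show ?thesis
    proof (cases "g 0 = 0")
      case True
      \<comment> \<open>Positivity keeps the truncated subtraction of one exact when the indices are
        shifted to the tail \<open>b\<close>.\<close>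
      have pos: "g (Suc i) > 0" if "i < length xs" for i
        using Cons.prems(2)[of 0 "Suc i"] that s by simp
      have "subseq xs b"
      proof (rule Cons.IH[of _ "\<lambda>i. g (Suc i) - 1"])
        fix i assume i: "i < length xs"
        then show "g (Suc i) - 1 < length b \<and> xs ! i = b ! (g (Suc i) - 1)"
          using Cons.prems(1)[of "Suc i"] pos[OF i] s by (cases "g (Suc i)") simp_all
      next
        fix i j assume "i < j" "j < length xs"
        then show "g (Suc i) - 1 < g (Suc j) - 1"
          using Cons.prems(2)[of "Suc i" "Suc j"] pos[of i] s by simp
      qed
      moreover have "x = y" using Cons.prems(1)[of 0] True s by simp
      ultimately show ?thesis using s by simp
    next
      case False
      have pos: "g i > 0" if "i < length s" for i
        using Cons.prems(2)[of 0 i] that False by (cases i) auto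
      have "subseq s b"
      proof (rule Cons.IH[of _ "\<lambda>i. g i - 1"])
        fix i assume i: "i < length s"
        then show "g i - 1 < length b \<and> s ! i = b ! (g i - 1)"
          using Cons.prems(1)[of i] pos[OF i] by (cases "g i") simp_all
      next
        fix i j assume "i < j" "j < length s"
        then show "g i - 1 < g j - 1"
          using Cons.prems(2)[of i j] pos[of i] by simp
      qed
      then show ?thesis by (rule list_emb_Cons)
    qed
  qed
qed

lemma represents_fst_less:
  assumes "represents p l S" "i < length l" "j < length l"
  shows "fst (l ! i) < fst (l ! j) \<longleftrightarrow> i < j"
proof -
  have less: "fst (l ! i) < fst (l ! j)" if "i < j" "j < length l" for i j
    using assms(1) that by (simp add: represents_def)
  show ?thesis
    using less[of i j] less[of j i] assms(2,3) by (cases i j rule: linorder_cases) simp_all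
qed

text \<open>Through \<open>l\<close>, increasing positions in \<open>p\<close> correspond to points
  of \<open>S\<close> taken from left to right, and comparisons of entries to comparisons of
  heights.\<close>

lemma contained_in_iff_occurs:
  assumes r: "represents p l S"
  shows "contained_in q p \<longleftrightarrow> occurs q S"
proof
  have len: "length p = length l" and S: "set l = S"
    and snd: "\<And>i j. i < length l \<Longrightarrow> j < length l \<Longrightarrow> p ! i < p ! j \<longleftrightarrow> snd (l ! i) < snd (l ! j)"
    using r by (simp_all add: represents_def)
  {
    assume "contained_in q p"
    then obtain s where s: "subseq s p" "order_isomorphic s q" by (auto simp: contained_in_def)
    obtain g where g: "\<forall>i<length s. g i < length p \<and> s ! i = p ! g i"
      "\<forall>j<length s. \<forall>i<j. g i < (g j :: nat)"
      using subseq_imp_indices[OF s(1)] by (elim exE conjE)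
    have len': "length s = length q" using s(2) by (simp add: order_isomorphic_def)
    show "occurs q S" unfolding occurs_def
    proof (intro exI[of _ "\<lambda>i. l ! g i"] conjI allI impI)
      fix i assume "i < length q"
      then show "l ! g i \<in> S" using g(1) len len' S nth_mem by metis
    next
      fix i j assume "j < length q" "i < j"
      then show "fst (l ! g i) < fst (l ! g j)"
        using g len len' represents_fst_less[OF r, of "g i" "g j"] by simp
    next
      fix i j assume "i < length q" "j < length q"
      then show "q ! i < q ! j \<longleftrightarrow> snd (l ! g i) < snd (l ! g j)"
        using s(2) g(1) len len' snd[of "g i" "g j"] by (simp add: order_isomorphic_def)
    qed
  }
  assume "occurs q S"
  then obtain f where f: "\<forall>i<length q. f i \<in> S" "\<forall>j<length q. \<forall>i<j. fst (f i) < fst (f j)"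
    "\<forall>i<length q. \<forall>j<length q. q ! i < q ! j \<longleftrightarrow> snd (f i) < snd (f j)"
    unfolding occurs_def by (elim exE conjE)
  have "\<forall>i. \<exists>k. i < length q \<longrightarrow> k < length l \<and> l ! k = f i"
    using f(1) S by (metis in_set_conv_nth)
  then obtain g where g: "\<And>i. i < length q \<Longrightarrow> g i < length l \<and> l ! g i = f i" by metis
  define s where "s = map (\<lambda>i. p ! g i) [0..<length q]"
  have "subseq s p"
  proof (rule subseq_indicesI[of _ g])
    fix i assume "i < length s"
    then show "g i < length p \<and> s ! i = p ! g i" using g[of i] len by (simp add: s_def)
  next
    fix i j assume "i < j" "j < length s"
    then show "g i < g j"
      using represents_fst_less[OF r, of "g i" "g j"] g[of i] g[of j] f(2) by (simp add: s_def)
  qed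
  moreover have "order_isomorphic s q"
    unfolding order_isomorphic_def using g f(3) snd by (simp add: s_def)
  ultimately show "contained_in q p" by (auto simp: contained_in_def)
qed

section \<open>Direct sums\<close>

lemma nth_direct_sum:
  "i < length a \<Longrightarrow> (a \<oplus> b) ! i = a ! i"
  "i < length b \<Longrightarrow> (a \<oplus> b) ! (length a + i) = length a + b ! i"
  by (simp_all add: direct_sum_def nth_append)

lemma is_perm_nth: "is_perm p \<Longrightarrow> i < length p \<Longrightarrow> 1 \<le> p ! i \<and> p ! i \<le> length p"
  using nth_mem[of i p] by (simp add: is_perm_def permutations_of_set_def)

text \<open>Entries of \<open>a\<close> are at most \<open>length a\<close>, and shifted entries of
  \<open>b\<close> exceed it. Cutting an occurrence after its first \<open>length a\<close> points
  therefore gives sets related by \<open>below_left\<close>; conversely, occurrences in such sets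
  can be concatenated.\<close>

lemma occurs_direct_sum:
  assumes a: "is_perm a" and b: "is_perm b"
  shows "occurs (a \<oplus> b) S \<longleftrightarrow>
    (\<exists>A B. A \<subseteq> S \<and> B \<subseteq> S \<and> below_left A B \<and> occurs a A \<and> occurs b B)"
proof
  have len: "length (a \<oplus> b) = length a + length b" by (simp add: direct_sum_def)
  have lt: "(a \<oplus> b) ! i < (a \<oplus> b) ! (length a + j)" if "i < length a" "j < length b" for i j
    using is_perm_nth[OF a that(1)] is_perm_nth[OF b that(2)] that by (simp add: nth_direct_sum)
  {
    assume "occurs (a \<oplus> b) S"
    then obtain f where f: "\<forall>i<length a + length b. f i \<in> S"
      "\<forall>j<length a + length b. \<forall>i<j. fst (f i) < fst (f j)"
      "\<forall>i<length a + length b. \<forall>j<length a + length b.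
         (a \<oplus> b) ! i < (a \<oplus> b) ! j \<longleftrightarrow> snd (f i) < snd (f j)"
      unfolding occurs_def len by (elim exE conjE)
    let ?A = "f ` {..<length a}" and ?B = "(\<lambda>i. f (length a + i)) ` {..<length b}"
    have "fst (f i) < fst (f (length a + j)) \<and> snd (f i) < snd (f (length a + j))"
      if "i < length a" "j < length b" for i j
      using that lt[OF that] f(2,3) by simp
    then have "below_left ?A ?B" unfolding below_left_def by auto
    moreover have "occurs a ?A" unfolding occurs_def
    proof (intro exI[of _ f] conjI allI impI)
      fix i j assume "i < length a" "j < length a"
      then show "a ! i < a ! j \<longleftrightarrow> snd (f i) < snd (f j)"
        using f(3)[rule_format, of i j] by (simp add: nth_direct_sum)
    qed (use f in simp_all)
    moreover have "occurs b ?B" unfolding occurs_def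
    proof (intro exI[of _ "\<lambda>i. f (length a + i)"] conjI allI impI)
      fix i j assume "i < length b" "j < length b"
      then show "b ! i < b ! j \<longleftrightarrow> snd (f (length a + i)) < snd (f (length a + j))"
        using f(3)[rule_format, of "length a + i" "length a + j"] by (simp add: nth_direct_sum)
    qed (use f in simp_all)
    moreover have "?A \<subseteq> S" "?B \<subseteq> S" using f(1) by auto
    ultimately show "\<exists>A B. A \<subseteq> S \<and> B \<subseteq> S \<and> below_left A B \<and> occurs a A \<and> occurs b B"
      by (intro exI[of _ ?A] exI[of _ ?B] conjI)
  }
  assume "\<exists>A B. A \<subseteq> S \<and> B \<subseteq> S \<and> below_left A B \<and> occurs a A \<and> occurs b B"
  then obtain A B where AB: "A \<subseteq> S" "B \<subseteq> S" "below_left A B" "occurs a A" "occurs b B"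
    by (elim exE conjE)
  obtain f where f: "\<And>i. i < length a \<Longrightarrow> f i \<in> A"
    "\<And>i j. i < j \<Longrightarrow> j < length a \<Longrightarrow> fst (f i) < fst (f j)"
    "\<And>i j. i < length a \<Longrightarrow> j < length a \<Longrightarrow> a ! i < a ! j \<longleftrightarrow> snd (f i) < snd (f j)"
    using AB(4) unfolding occurs_def by metis
  obtain g where g: "\<And>i. i < length b \<Longrightarrow> g i \<in> B"
    "\<And>i j. i < j \<Longrightarrow> j < length b \<Longrightarrow> fst (g i) < fst (g j)"
    "\<And>i j. i < length b \<Longrightarrow> j < length b \<Longrightarrow> b ! i < b ! j \<longleftrightarrow> snd (g i) < snd (g j)"
    using AB(5) unfolding occurs_def by metis
  have fg: "fst (f i) < fst (g j) \<and> snd (f i) < snd (g j)" if "i < length a" "j < length b" for i j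
    using AB(3) f(1)[OF that(1)] g(1)[OF that(2)] unfolding below_left_def by simp
  define h where "h i = (if i < length a then f i else g (i - length a))" for i
  have split: "i < length a \<or> (\<exists>k<length b. i = length a + k)" if "i < length a + length b" for i
    using that by presburger
  show "occurs (a \<oplus> b) S" unfolding occurs_def len
  proof (intro exI[of _ h] conjI allI impI)
    fix i assume "i < length a + length b"
    then show "h i \<in> S" using f(1)[of i] g(1)[of "i - length a"] AB(1,2)
      by (auto simp: h_def)
  next
    fix i j assume "j < length a + length b" "i < j"
    then show "fst (h i) < fst (h j)"
      using f(2)[of i j] g(2)[of "i - length a" "j - length a"] fg[of i "j - length a"]
      by (auto simp: h_def)
  next
    fix i j assume ij: "i < length a + length b" "j < length a + length b"
    show "(a \<oplus> b) ! i < (a \<oplus> b) ! j \<longleftrightarrow> snd (h i) < snd (h j)"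
    proof (cases "i < length a")
      case i: True
      show ?thesis
      proof (cases "j < length a")
        case True
        then show ?thesis using i f(3) by (simp add: h_def nth_direct_sum)
      next
        case False
        then obtain k where k: "k < length b" "j = length a + k" using split ij by blast
        then show ?thesis using lt[OF i k(1)] fg[OF i k(1)] i by (simp add: h_def)
      qed
    next
      case i: False
      then obtain m where m: "m < length b" "i = length a + m" using split ij by blast
      show ?thesis
      proof (cases "j < length a")
        case True
        then show ?thesis using lt[OF True m(1)] fg[OF True m(1)] m by (simp add: h_def)
      next
        case False
        then obtain k where k: "k < length b" "j = length a + k" using split ij by blast
        then show ?thesis using m g(3) by (simp add: h_def nth_direct_sum)
      qed
    qed
  qed
qed

section \<open>Passing between permutations and generic point sets\<close>

lemma represents_perm:
  assumes "is_perm p"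
  shows "\<exists>l S. represents p l S \<and> generic S"
proof -
  let ?f = "\<lambda>i. (real i, real (p ! i))"
  let ?l = "map ?f [0..<length p]"
  have "represents p ?l (set ?l)" by (simp add: represents_def)
  moreover have "distinct p" using assms by (simp add: is_perm_def permutations_of_set_def)
  then have "generic (set ?l)" by (auto simp: generic_def inj_on_def nth_eq_iff_index_eq)
  ultimately show ?thesis by (intro exI conjI)
qed

text \<open>The points are read from left to right and each height is replaced by its rank. Ranks
  are distinct and lie in \<open>{1..card S}\<close>, so they fill that range.\<close>

lemma exists_represents:
  assumes S: "generic S"
  shows "\<exists>p l. represents p l S \<and> is_perm p"
proof -
  have fin: "finite S" and inj: "inj_on fst S" using S by (simp_all add: generic_def)
  define xs where "xs = sorted_list_of_set (fst ` S)"
  define l where "l = map (the_inv_into S fst) xs"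
  \<comment> \<open>The non-strict inequality counts the point itself, so ranks start at 1.\<close>
  define rank where "rank t = card {z\<in>S. snd z \<le> snd t}" for t :: point
  have set_xs: "set xs = fst ` S" using fin by (simp add: xs_def)
  have fst_l: "fst (l ! i) = xs ! i" if "i < length xs" for i
    unfolding l_def using that f_the_inv_into_f[OF inj] set_xs nth_mem[OF that] by simp
  have set_l: "set l = S"
    unfolding l_def using set_xs the_inv_into_onto[OF inj] by simp
  have len: "length l = length xs" by (simp add: l_def)
  have sorted: "xs ! i < xs ! j" if "i < j" "j < length xs" for i j
    using sorted_wrt_nth_less[OF strict_sorted_list_of_set that[unfolded xs_def]] by (simp add: xs_def)
  have rank_less: "rank s < rank t" if "s \<in> S" "t \<in> S" "snd s < snd t" for s t
  proof -
    have "{z\<in>S. snd z \<le> snd s} \<subseteq> {z\<in>S. snd z \<le> snd t}" using that(3) by auto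
    moreover have "t \<in> {z\<in>S. snd z \<le> snd t}" "t \<notin> {z\<in>S. snd z \<le> snd s}" using that by simp_all
    ultimately have "{z\<in>S. snd z \<le> snd s} \<subset> {z\<in>S. snd z \<le> snd t}" by blast
    then show ?thesis unfolding rank_def using fin by (intro psubset_card_mono) simp_all
  qed
  have rank_iff: "rank s < rank t \<longleftrightarrow> snd s < snd t" if "s \<in> S" "t \<in> S" for s t
  proof
    assume less: "rank s < rank t"
    show "snd s < snd t"
    proof (rule ccontr)
      assume "\<not> snd s < snd t"
      then have "{z\<in>S. snd z \<le> snd t} \<subseteq> {z\<in>S. snd z \<le> snd s}" by auto
      then have "rank t \<le> rank s" unfolding rank_def using fin by (intro card_mono) simp_all
      with less show False by simp
    qed
  qed (rule rank_less[OF that])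
  have distinct_l: "distinct l"
    unfolding distinct_conv_nth using sorted fst_l len by (metis less_irrefl linorder_neqE_nat)
  have inj_rank: "inj_on rank S"
  proof (rule inj_onI)
    fix s t assume "s \<in> S" "t \<in> S" "rank s = rank t"
    then have "snd s = snd t" using rank_less[of s t] rank_less[of t s]
      by (cases "snd s" "snd t" rule: linorder_cases) simp_all
    then show "s = t" using generic_eqI[OF S \<open>s \<in> S\<close> \<open>t \<in> S\<close>] by simp
  qed
  have len_card: "length l = card S" using distinct_card[OF distinct_l] set_l by simp
  have "rank ` S \<subseteq> {1..card S}"
  proof
    fix k assume "k \<in> rank ` S"
    then obtain t where t: "t \<in> S" "k = rank t" by blast
    have "t \<in> {z\<in>S. snd z \<le> snd t}" using t(1) by simp
    then have "{z\<in>S. snd z \<le> snd t} \<noteq> {}" by blast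
    then have "k > 0" unfolding t(2) rank_def card_gt_0_iff using fin by simp
    moreover have "k \<le> card S" unfolding t(2) rank_def using fin by (intro card_mono) auto
    ultimately show "k \<in> {1..card S}" by simp
  qed
  then have "rank ` S = {1..card S}"
    using card_image[OF inj_rank] by (intro card_subset_eq) simp_all
  then have "is_perm (map rank l)"
    using distinct_l inj_rank set_l len_card
    by (simp add: is_perm_def permutations_of_set_def distinct_map)
  moreover have "represents (map rank l) l S"
    unfolding represents_def
  proof (intro conjI allI impI)
    fix i j assume ij: "i < length l" "j < length l"
    then have "l ! i \<in> S" "l ! j \<in> S" using nth_mem set_l by auto
    then show "map rank l ! i < map rank l ! j \<longleftrightarrow> snd (l ! i) < snd (l ! j)"
      using ij rank_iff by simp
  next
    fix i j assume "j < length l" "i < j"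
    then show "fst (l ! i) < fst (l ! j)" using sorted[of i j] fst_l len by simp
  qed (simp_all add: set_l)
  ultimately show ?thesis by (intro exI conjI)
qed

text \<open>The points of an interval of \<open>p\<close> form a block of \<open>S\<close>. With two
  entries this block would be all of \<open>S\<close>, contradicting properness of the
  interval.\<close>

lemma represents_simple:
  assumes r: "represents p l S" and p: "is_perm p" and simple: "simple_points S"
  shows "simple_perm p"
  unfolding simple_perm_def
proof (intro conjI allI impI)
  show "is_perm p" by (rule p)
  fix I assume "perm_interval p I"
  then obtain a b c d where ne: "I \<noteq> {}" and sub: "I \<subset> {..<length p}"
    and ab: "I = {a..b}" and cd: "(!) p ` I = {c..d}"
    unfolding perm_interval_def consecutive_def by (elim conjE exE)
  have len: "length p = length l" and S: "set l = S"
    and snd: "\<And>i j. i < length l \<Longrightarrow> j < length l \<Longrightarrow> snd (l ! i) < snd (l ! j) \<longleftrightarrow> p ! i < p ! j"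
    using r by (simp_all add: represents_def)
  have bnd: "i < length l" if "i \<in> I" for i using sub that len by auto
  have inj_p: "i = j" if "p ! i = p ! j" "i < length l" "j < length l" for i j
    using p that len by (simp add: is_perm_def permutations_of_set_def nth_eq_iff_index_eq)
  have inj_l: "i = j" if "l ! i = l ! j" "i < length l" "j < length l" for i j
    using represents_fst_less[OF r] that by (metis less_irrefl linorder_neqE_nat)
  have "block S ((!) l ` I)" unfolding block_def
  proof (intro conjI ballI)
    show "(!) l ` I \<subseteq> S" using bnd S by auto
    fix t u v assume t: "t \<in> S - (!) l ` I" and u: "u \<in> (!) l ` I" and v: "v \<in> (!) l ` I"
    have "t \<in> set l" using t S by simp
    then obtain k where kl: "k < length l" "t = l ! k" unfolding in_set_conv_nth by blast
    then have k: "k < length l" "t = l ! k" "k \<notin> I" using t by auto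
    obtain i j where ij: "i \<in> I" "u = l ! i" "j \<in> I" "v = l ! j" using u v by blast
    show "\<not> (fst u < fst t \<and> fst t < fst v)"
      using represents_fst_less[OF r bnd[OF ij(1)] k(1)] represents_fst_less[OF r k(1) bnd[OF ij(3)]]
        ij k ab by auto
    show "\<not> (snd u < snd t \<and> snd t < snd v)"
    proof
      assume "snd u < snd t \<and> snd t < snd v"
      then have "p ! i < p ! k" "p ! k < p ! j"
        using snd[OF bnd[OF ij(1)] k(1)] snd[OF k(1) bnd[OF ij(3)]] ij k by simp_all
      moreover have "p ! i \<in> {c..d}" "p ! j \<in> {c..d}" using ij cd by blast+
      ultimately have "p ! k \<in> (!) p ` I" unfolding cd by simp
      then obtain m where m: "m \<in> I" "p ! k = p ! m" by blast
      then show False using inj_p[OF m(2) k(1) bnd[OF m(1)]] k(3) by simp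
    qed
  qed
  then have full: "(!) l ` I = S" if "i \<in> I" "j \<in> I" "i \<noteq> j" for i j
    using simple that inj_l[of i j] bnd unfolding simple_points_def by blast
  obtain i where i: "i \<in> I" using ne by blast
  have "j = i" if j: "j \<in> I" for j
  proof (rule ccontr)
    assume "j \<noteq> i"
    then have S': "(!) l ` I = S" using full j i by blast
    obtain k where k: "k < length l" "k \<notin> I" using sub len by auto
    then have "l ! k \<in> (!) l ` I" using S S' nth_mem by blast
    then obtain m where "m \<in> I" "l ! k = l ! m" by blast
    then show False using inj_l[of k m] k bnd by blast
  qed
  then have "I = {i}" using i by blast
  then show "card I = 1" by simp
qed

text \<open>If \<open>C\<close> lies in the closure of \<open>D\<close>, the simple permutations of
  \<open>C\<close> are already in \<open>D\<close>, as the closure adds no simple ones. Since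
  \<open>D\<close> is closed under containment, it then contains all of \<open>C\<close>.\<close>

lemma not_deflatableI:
  assumes "\<And>s. s \<in> C \<Longrightarrow> \<exists>p\<in>C. simple_perm p \<and> contained_in s p" "\<And>s. s \<in> C \<Longrightarrow> is_perm s"
  shows "\<not> deflatable C"
proof
  assume "deflatable C"
  then obtain D where D: "perm_class D" "D \<subset> C" "C \<subseteq> substitution_closure D"
    unfolding deflatable_def by (elim exE conjE)
  have "s \<in> D" if s: "s \<in> C" for s
  proof -
    obtain p where p: "p \<in> C" "simple_perm p" "contained_in s p" using assms(1)[OF s] by blast
    then have "p \<in> simples D"
      using substitution_closure_greatest(2)[OF D(1)] D(3) by (auto simp: simples_def)
    then have "p \<in> D" by (simp add: simples_def)
    then show "s \<in> D" using D(1) p(3) assms(2)[OF s] unfolding perm_class_def by blast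
  qed
  then show False using D(2) by blast
qed

theorem theorem3p1:
  fixes lam mu rho \<pi> :: "nat list"
  assumes "is_perm lam" and "is_perm mu" and "is_perm rho"
    and "lam \<noteq> []" and "mu \<noteq> []" and "rho \<noteq> []"
    and "\<pi> = lam \<oplus> mu \<oplus> rho"
  shows "\<not> deflatable (Av \<pi>)"
proof -
  interpret three_parts "occurs lam" "occurs mu" "occurs rho"
    by unfold_locales (use assms(4-6) occurs_mono in \<open>simp_all add: occurs_empty\<close>)
  \<comment> \<open>As \<open>\<oplus>\<close> associates to the left, \<open>rho\<close> is split
    off first and \<open>lam \<oplus> mu\<close> is split afterwards.\<close>
  have pi: "occurs \<pi> S \<longleftrightarrow> has_LMR S" for S
  proof
    assume "occurs \<pi> S"
    then obtain AB C where 1: "AB \<subseteq> S" "C \<subseteq> S" "below_left AB C" "occurs (lam \<oplus> mu) AB" "occurs rho C"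
      unfolding assms(7) occurs_direct_sum[OF is_perm_direct_sum[OF assms(1,2)] assms(3)]
      by (elim exE conjE)
    obtain A B where 2: "A \<subseteq> AB" "B \<subseteq> AB" "below_left A B" "occurs lam A" "occurs mu B"
      using 1(4) unfolding occurs_direct_sum[OF assms(1,2)] by (elim exE conjE)
    show "has_LMR S"
      by (rule has_LMRI[OF _ _ 1(2) 2(3) _ _ 2(4,5) 1(5)])
        (use 1 2 below_left_mono[OF 1(3)] in auto)
  next
    assume "has_LMR S"
    then obtain A B C where 1: "A \<subseteq> S" "B \<subseteq> S" "C \<subseteq> S" "below_left A B" "below_left A C"
      "below_left B C" "occurs lam A" "occurs mu B" "occurs rho C"
      unfolding has_LMR_def by (elim exE conjE)
    have "occurs (lam \<oplus> mu) (A \<union> B)"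
      unfolding occurs_direct_sum[OF assms(1,2)] using 1
      by (intro exI[of _ A] exI[of _ B]) simp
    moreover have "below_left (A \<union> B) C" using 1(5,6) unfolding below_left_def by blast
    ultimately show "occurs \<pi> S"
      unfolding assms(7) occurs_direct_sum[OF is_perm_direct_sum[OF assms(1,2)] assms(3)]
      using 1 by (intro exI[of _ "A \<union> B"] exI[of _ C]) simp
  qed
  show ?thesis
  proof (rule not_deflatableI)
    fix s assume "s \<in> Av \<pi>"
    then have s: "is_perm s" "\<not> contained_in \<pi> s" by (simp_all add: Av_def)
    then show "is_perm s" by simp
    obtain l S where S: "represents s l S" "generic S"
      using represents_perm[OF s(1)] by (elim exE conjE)
    have "\<not> has_LMR S" using s(2) unfolding contained_in_iff_occurs[OF S(1)] pi .
    from exists_simple_superset[OF S(2) this]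
    obtain U where U: "S \<subseteq> U" "generic U" "\<not> has_LMR U" "simple_points U"
      by (elim exE conjE)
    obtain p m where p: "represents p m U" "is_perm p"
      using exists_represents[OF U(2)] by (elim exE conjE)
    have "\<not> contained_in \<pi> p" unfolding contained_in_iff_occurs[OF p(1)] pi by (rule U(3))
    \<comment> \<open>Containment of \<open>s\<close> in itself gives an occurrence in its own point
      set \<open>S\<close>, hence in \<open>U\<close>, hence containment in
      \<open>p\<close>.\<close>
    moreover have "order_isomorphic s s" by (simp add: order_isomorphic_def)
    then have "contained_in s s" by (auto simp: contained_in_def)
    then have "occurs s U" unfolding contained_in_iff_occurs[OF S(1)] using U(1) by (rule occurs_mono)
    then have "contained_in s p" unfolding contained_in_iff_occurs[OF p(1)] .
    ultimately show "\<exists>p\<in>Av \<pi>. simple_perm p \<and> contained_in s p"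
      using p(2) represents_simple[OF p U(4)] by (intro bexI[of _ p]) (simp_all add: Av_def)
  qed
qed

end
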